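(* Let $n$ be a positive integer, $x\in\mathbb{B}^n$ and $0<t<1$. For radii $r_0,r_1>0$, the inclusions $B^n(x,r_0)\subseteq B_s(x,t)\subseteq B^n(x,r_1)$ hold, where $B_s(x,t)$ is the triangular ratio metric ball in the domain $G=\mathbb{B}^n$, if and only if $$0<r_0\leq\frac{2t(1-|x|)}{1+t}\quad\text{and}\quad r_1\geq\min\left\{\frac{2t(1-|x|)}{1-t},\frac{2t(1+|x|)}{1+t}\right\}.$$
   Context: $B^n(x,r)=\{y\in\mathbb{R}^n : |x-y|<r\}$ is the open Euclidean ball and $\mathbb{B}^n=B^n(0,1)$ is the unit ball. For a domain $G\subsetneq\mathbb{R}^n$, the triangular ratio metric is $s_G(x,y)=\dfrac{|x-y|}{\inf_{z\in\partial G}(|x-z|+|z-y|)}$ for $x,y\in G$, and $B_s(x,t)=\{y\in G : s_G(x,y)<t\}$. *)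

theory Defs
  imports "HOL-Analysis.Analysis"
begin

(* Intended for a domain G that is not the whole space, with x and y in G; then the
   frontier of G is nonempty and the infimum is a positive real number. *)
definition triangular_ratio :: "'a::euclidean_space set \<Rightarrow> 'a \<Rightarrow> 'a \<Rightarrow> real" where
  "triangular_ratio G x y = dist x y / (INF z\<in>frontier G. dist x z + dist z y)"

definition triangular_ratio_ball :: "'a::euclidean_space set \<Rightarrow> 'a \<Rightarrow> real \<Rightarrow> 'a set" where
  "triangular_ratio_ball G x t = {y \<in> G. triangular_ratio G x y < t}"

end

theory Submission imports Defs begin

text \<open>
  Since the boundary of a bounded domain is compact, \<open>y\<close> lies in the metric ball of radius \<open>t\<close>
  about \<open>x\<close> exactly when \<open>|x - y| < t (|x - z| + |z - y|)\<close> for every boundary point \<open>z\<close>.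
  With \<open>r = |x - y|\<close> and \<open>z\<close> on the unit sphere, everything follows from testing a few \<open>z\<close>.

  \<^item> Always \<open>|x - z| + |z - y| \<ge> 2 |x - z| - r \<ge> 2 (1 - |x|) - r\<close>, with equality if
    \<open>y\<close> lies between \<open>x\<close> and its nearest boundary point \<open>z\<close>. The condition
    \<open>r < t (2 (1 - |x|) - r)\<close> gives the inner radius.

  \<^item> The boundary point nearest to \<open>x\<close> gives a detour of at most \<open>2 (1 - |x|) + r\<close>; the exit
    point of the ray from \<open>x\<close> through \<open>y\<close> gives one of at most \<open>2 (1 + |x|) - r\<close>. The
    conditions \<open>r < t (2 (1 - |x|) + r)\<close> and \<open>r < t (2 (1 + |x|) - r)\<close> give the two terms of
    the outer radius.

  \<^item> The outer radius is optimal because both detours are attained simultaneously when \<open>y\<close>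
    moves from \<open>x\<close> along the diameter away from the nearest boundary point. For two points on one
    diameter, the length of the detour through \<open>z\<close> is a concave function of the cosine of the
    angle between \<open>z\<close> and the diameter, so that the shortest detour passes through an end of
    the diameter.
\<close>

lemma triangular_ratio_less_iff:
  fixes G :: "'a::euclidean_space set"
  assumes "open G" "bounded G" "x \<in> G" "y \<in> G"
  shows "triangular_ratio G x y < t \<longleftrightarrow>
         (\<forall>z\<in>frontier G. dist x y < t * (dist x z + dist z y))"
proof -
  define f where "f = (\<lambda>z. dist x z + dist z y)"
  have "G \<noteq> UNIV"
    using assms(2) not_bounded_UNIV by auto
  then have ne: "frontier G \<noteq> {}"
    using assms(3) by (auto simp: frontier_eq_empty)
  have "continuous_on (frontier G) f"
    unfolding f_def by (intro continuous_intros)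
  then obtain w where w: "w \<in> frontier G" "\<And>z. z \<in> frontier G \<Longrightarrow> f w \<le> f z"
    using continuous_attains_inf[OF compact_frontier_bounded[OF assms(2)] ne] by blast
  have inf: "(INF z\<in>frontier G. f z) = f w"
    using w by (intro cInf_eq_minimum) auto
  have "w \<noteq> x"
    using w(1) assms(1,3) by (auto simp: frontier_def interior_open)
  then have pos: "f w > 0"
    unfolding f_def by (simp add: add_pos_nonneg)
  have "triangular_ratio G x y < t \<longleftrightarrow> dist x y / f w < t"
    using inf by (simp add: triangular_ratio_def f_def)
  also have "\<dots> \<longleftrightarrow> dist x y < t * f w"
    using pos by (simp add: pos_divide_less_eq)
  also have "\<dots> \<longleftrightarrow> (\<forall>z\<in>frontier G. dist x y < t * f z)"
  proof
    assume *: "dist x y < t * f w"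
    \<comment> \<open>The quotient of distances is nonnegative, so this can only hold for positive \<open>t\<close>.\<close>
    then have "t > 0"
      by (smt (verit) pos zero_le_dist mult_nonpos_nonneg)
    then show "\<forall>z\<in>frontier G. dist x y < t * f z"
      using * w(2) by (meson less_le_trans mult_le_cancel_left_pos)
  qed (use w(1) in blast)
  finally show ?thesis
    unfolding f_def .
qed

lemma mem_triangular_ratio_unit_ball_iff:
  fixes x :: "'a::euclidean_space"
  assumes "x \<in> ball 0 1"
  shows "y \<in> triangular_ratio_ball (ball 0 1) x t \<longleftrightarrow>
         norm y < 1 \<and> (\<forall>z. norm z = 1 \<longrightarrow> dist x y < t * (dist x z + dist z y))"
  using triangular_ratio_less_iff[of "ball 0 1" x y t] assms
  by (auto simp: triangular_ratio_ball_def frontier_ball)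

lemma ex_unit_vector_direction:
  fixes x :: "'a::euclidean_space"
  obtains e where "norm e = 1" "x = norm x *\<^sub>R e"
proof (cases "x = 0")
  case True
  then show thesis
    using that vector_choose_size[of 1] by (metis norm_zero scaleR_zero_left zero_le_one)
next
  case False
  then show thesis
    using that[of "sgn x"] by (simp add: norm_sgn sgn_div_norm)
qed

lemma dist_scaleR_unit:
  fixes e :: "'a::real_normed_vector"
  assumes "norm e = 1"
  shows "dist (a *\<^sub>R e) (b *\<^sub>R e) = \<bar>a - b\<bar>"
  using assms by (simp add: dist_norm flip: scaleR_diff_left)

text \<open>
  With \<open>u = e \<bullet> z\<close>, the squared distance \<open>1 + a\<^sup>2 - 2 a u\<close> is affine in \<open>u\<close>, so the
  distance is concave in \<open>u\<close> and dominates its chord between \<open>u = 1\<close> and \<open>u = -1\<close>.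
\<close>

lemma dist_diameter_unit_vector_ge:
  fixes e z :: "'a::real_inner"
  assumes "norm e = 1" "norm z = 1"
  shows "(1 + e \<bullet> z) / 2 * \<bar>a - 1\<bar> + (1 - e \<bullet> z) / 2 * \<bar>a + 1\<bar> \<le> dist (a *\<^sub>R e) z"
proof -
  define u where "u = e \<bullet> z"
  have u: "\<bar>u\<bar> \<le> 1"
    using Cauchy_Schwarz_ineq2[of e z] assms by (simp add: u_def)
  have "(dist (a *\<^sub>R e) z)\<^sup>2 = a\<^sup>2 + 1 - 2 * a * u"
    using assms unfolding dist_norm power2_norm_eq_inner
    by (simp add: inner_diff inner_commute[of z e] norm_eq_1 u_def power2_eq_square
        algebra_simps)
  moreover have "((1 + u) / 2 * p + (1 - u) / 2 * q)\<^sup>2 \<le> (1 + u) / 2 * p\<^sup>2 + (1 - u) / 2 * q\<^sup>2"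
    for p q :: real
  proof -
    have "(1 + u) / 2 * p\<^sup>2 + (1 - u) / 2 * q\<^sup>2 - ((1 + u) / 2 * p + (1 - u) / 2 * q)\<^sup>2
        = (1 + u) / 2 * ((1 - u) / 2) * (p - q)\<^sup>2"
      by (simp add: power2_eq_square field_simps)
    moreover have "\<dots> \<ge> 0"
      using u by (intro mult_nonneg_nonneg) auto
    ultimately show ?thesis
      by linarith
  qed
  from this[of "\<bar>a - 1\<bar>" "\<bar>a + 1\<bar>"]
  have "((1 + u) / 2 * \<bar>a - 1\<bar> + (1 - u) / 2 * \<bar>a + 1\<bar>)\<^sup>2 \<le> a\<^sup>2 + 1 - 2 * a * u"
    by (simp add: power2_eq_square field_simps)
  ultimately have "((1 + u) / 2 * \<bar>a - 1\<bar> + (1 - u) / 2 * \<bar>a + 1\<bar>)\<^sup>2 \<le> (dist (a *\<^sub>R e) z)\<^sup>2"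
    by (simp only:)
  then show ?thesis
    unfolding u_def by (rule power2_le_imp_le) (rule zero_le_dist)
qed

text \<open>
  The chords for \<open>a\<close> and \<open>b\<close> have the same weights, so their sum is a convex combination of the
  lengths of the detours through \<open>e\<close> and through \<open>- e\<close>.
\<close>

lemma detour_between_diameter_points_ge:
  fixes e z :: "'a::real_inner"
  assumes "norm e = 1" "norm z = 1"
  shows "min (\<bar>a - 1\<bar> + \<bar>b - 1\<bar>) (\<bar>a + 1\<bar> + \<bar>b + 1\<bar>) \<le> dist (a *\<^sub>R e) z + dist z (b *\<^sub>R e)"
proof -
  define l where "l = (1 + e \<bullet> z) / 2"
  have l: "0 \<le> l" "l \<le> 1"
    using Cauchy_Schwarz_ineq2[of e z] assms by (auto simp: l_def)
  have "(1 - e \<bullet> z) / 2 = 1 - l"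
    by (simp add: l_def field_simps)
  then have *: "l * \<bar>c - 1\<bar> + (1 - l) * \<bar>c + 1\<bar> \<le> dist (c *\<^sub>R e) z" for c
    using dist_diameter_unit_vector_ge[OF assms, of c] by (simp only: flip: l_def)
  have "min A B \<le> l * A + (1 - l) * B" for A B :: real
    using convex_bound_le[of "- A" "- min A B" "- B" l "1 - l"] l by simp
  from this[of "\<bar>a - 1\<bar> + \<bar>b - 1\<bar>" "\<bar>a + 1\<bar> + \<bar>b + 1\<bar>"] *[of a] *[of b]
  show ?thesis
    by (simp add: dist_commute algebra_simps)
qed

text \<open>
  The exit point \<open>z\<close> of the ray from \<open>x\<close> through \<open>y\<close> has \<open>|x - z| + |z - y| = 2 |x - z| - |x - y|\<close>,
  and no point of the sphere is farther from \<open>x\<close> than \<open>1 + |x|\<close>.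
\<close>

lemma ex_detour_beyond:
  fixes x y :: "'a::euclidean_space"
  assumes "norm x < 1" "norm y < 1" "x \<noteq> y"
  obtains z where "norm z = 1" "dist x z + dist z y \<le> 2 * (1 + norm x) - dist x y"
proof -
  obtain d where d: "0 < d" "y + d *\<^sub>R (y - x) \<in> frontier (ball 0 1)"
    using ray_to_frontier[of "ball 0 1" y "y - x"] assms by (auto simp: interior_open)
  define z where "z = y + d *\<^sub>R (y - x)"
  have nz: "norm z = 1"
    using d(2) by (simp add: frontier_ball z_def)
  have "z - x = (1 + d) *\<^sub>R (y - x)"
    by (simp add: z_def algebra_simps)
  then have "dist x z = (1 + d) * dist x y"
    using d(1) by (simp add: dist_norm norm_minus_commute[of x])
  moreover have "dist z y = d * dist x y"
    using d(1) by (simp add: z_def dist_norm norm_minus_commute)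
  moreover have "dist x z \<le> 1 + norm x"
    using norm_triangle_ineq4[of x z] nz by (simp add: dist_norm)
  ultimately show thesis
    using that[OF nz] by (simp add: algebra_simps)
qed

lemma ball_subset_triangular_ratio_unit_ball_iff:
  fixes x :: "'a::euclidean_space"
  assumes x: "norm x < 1" and t: "0 < t" "t < 1"
  shows "ball x r \<subseteq> triangular_ratio_ball (ball 0 1) x t \<longleftrightarrow> r \<le> 2 * t * (1 - norm x) / (1 + t)"
    (is "_ \<longleftrightarrow> r \<le> ?R")
proof -
  have xb: "x \<in> ball 0 1"
    using x by simp
  have R: "?R * (1 + t) = 2 * t * (1 - norm x)"
    using t by simp
  have "2 * t * (1 - norm x) < (1 - norm x) * (1 + t)"
    using mult_strict_right_mono[of "2 * t" "1 + t" "1 - norm x"] x t by (simp add: mult.commute)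
  then have R_less: "?R < 1 - norm x"
    using t by (simp add: pos_divide_less_eq)
  show ?thesis
  proof
    assume r: "r \<le> ?R"
    show "ball x r \<subseteq> triangular_ratio_ball (ball 0 1) x t"
    proof
      fix y assume "y \<in> ball x r"
      then have y: "dist x y < ?R"
        using r by simp
      have "norm y < 1"
        using y R_less norm_triangle_ineq2[of y x] by (simp add: dist_norm norm_minus_commute)
      moreover have "dist x y < t * (dist x z + dist z y)" if "norm z = 1" for z
      proof -
        have "1 - norm x \<le> dist x z"
          using norm_triangle_ineq2[of z x] that by (simp add: dist_norm norm_minus_commute)
        moreover have "dist x z \<le> dist x y + dist z y"
          by (metis dist_commute dist_triangle)
        ultimately have "t * (2 * (1 - norm x) - dist x y) \<le> t * (dist x z + dist z y)"
          using t by (intro mult_left_mono) auto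
        moreover have "dist x y * (1 + t) < 2 * t * (1 - norm x)"
          using mult_strict_right_mono[OF y, of "1 + t"] R t by simp
        ultimately show ?thesis
          by (simp add: algebra_simps)
      qed
      ultimately show "y \<in> triangular_ratio_ball (ball 0 1) x t"
        using mem_triangular_ratio_unit_ball_iff[OF xb] by blast
    qed
  next
    assume sub: "ball x r \<subseteq> triangular_ratio_ball (ball 0 1) x t"
    show "r \<le> ?R"
    proof (rule ccontr)
      assume r: "\<not> r \<le> ?R"
      obtain e where e: "norm e = 1" "x = norm x *\<^sub>R e"
        by (rule ex_unit_vector_direction)
      \<comment> \<open>The extremal point: at distance exactly \<open>?R\<close> towards the nearest boundary point \<open>e\<close>.\<close>
      define y where "y = (norm x + ?R) *\<^sub>R e"
      have "?R \<ge> 0"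
        using x t by simp
      have xy: "dist x y = ?R"
      proof -
        have "dist x y = \<bar>norm x - (norm x + ?R)\<bar>"
          using dist_scaleR_unit[OF e(1)] e(2) y_def by metis
        then show ?thesis
          using \<open>?R \<ge> 0\<close> by linarith
      qed
      then have "y \<in> triangular_ratio_ball (ball 0 1) x t"
        using sub r by auto
      then have "dist x y < t * (dist x e + dist e y)"
        using mem_triangular_ratio_unit_ball_iff[OF xb] e(1) by blast
      moreover have "dist x e = 1 - norm x"
        using dist_scaleR_unit[OF e(1), of "norm x" 1] e(2) x by simp
      moreover have "dist e y = 1 - norm x - ?R"
        using dist_scaleR_unit[OF e(1), of 1 "norm x + ?R"] R_less by (simp add: y_def)
      ultimately have "?R < t * ((1 - norm x) + (1 - norm x - ?R))"
        using xy by simp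
      then have "?R * (1 + t) < 2 * t * (1 - norm x)"
        by (simp only: algebra_simps)
      then show False
        using R by linarith
    qed
  qed
qed

lemma triangular_ratio_unit_ball_subset_ball_iff:
  fixes x :: "'a::euclidean_space"
  assumes x: "norm x < 1" and t: "0 < t" "t < 1" and r: "r > 0"
  shows "triangular_ratio_ball (ball 0 1) x t \<subseteq> ball x r \<longleftrightarrow>
         min (2 * t * (1 - norm x) / (1 - t)) (2 * t * (1 + norm x) / (1 + t)) \<le> r"
    (is "_ \<longleftrightarrow> min ?R1 ?R2 \<le> r")
proof -
  have xb: "x \<in> ball 0 1"
    using x by simp
  obtain e where e: "norm e = 1" "x = norm x *\<^sub>R e"
    by (rule ex_unit_vector_direction)
  have less_R1: "s < ?R1 \<longleftrightarrow> s < t * (2 * (1 - norm x) + s)" for s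
    using t by (simp add: pos_less_divide_eq algebra_simps)
  have less_R2: "s < ?R2 \<longleftrightarrow> s < t * (2 * (1 + norm x) - s)" for s
    using t by (simp add: pos_less_divide_eq algebra_simps)
  show ?thesis
  proof
    assume le: "min ?R1 ?R2 \<le> r"
    show "triangular_ratio_ball (ball 0 1) x t \<subseteq> ball x r"
    proof
      fix y assume "y \<in> triangular_ratio_ball (ball 0 1) x t"
      then have y: "norm y < 1" "\<And>z. norm z = 1 \<Longrightarrow> dist x y < t * (dist x z + dist z y)"
        using mem_triangular_ratio_unit_ball_iff[OF xb] by blast+
      have "dist x e = 1 - norm x"
        using dist_scaleR_unit[OF e(1), of "norm x" 1] e(2) x by simp
      moreover have "dist e y \<le> dist x e + dist x y"
        by (rule dist_triangle3)
      ultimately have "t * (dist x e + dist e y) \<le> t * (2 * (1 - norm x) + dist x y)"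
        using t by (intro mult_left_mono) auto
      with y(2)[OF e(1)] have 1: "dist x y < ?R1"
        unfolding less_R1 by linarith
      have 2: "dist x y < ?R2"
      proof (cases "x = y")
        case True
        then show ?thesis
          using t by (simp add: add_pos_nonneg)
      next
        case False
        then obtain z where z: "norm z = 1" "dist x z + dist z y \<le> 2 * (1 + norm x) - dist x y"
          using ex_detour_beyond x y(1) by blast
        then have "t * (dist x z + dist z y) \<le> t * (2 * (1 + norm x) - dist x y)"
          using t by (intro mult_left_mono) auto
        with y(2)[OF z(1)] show ?thesis
          unfolding less_R2 by linarith
      qed
      from 1 2 le show "y \<in> ball x r"
        by simp
    qed
  next
    assume sub: "triangular_ratio_ball (ball 0 1) x t \<subseteq> ball x r"
    show "min ?R1 ?R2 \<le> r"
    proof (rule ccontr)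
      assume "\<not> min ?R1 ?R2 \<le> r"
      then have r1: "r < ?R1" and r2: "r < ?R2"
        by auto
      have "2 * t * (1 + norm x) < (1 + norm x) * (1 + t)"
        using mult_strict_right_mono[of "2 * t" "1 + t" "1 + norm x"] t
        by (simp add: mult.commute add_pos_nonneg)
      then have "?R2 < 1 + norm x"
        using t by (simp add: pos_divide_less_eq)
      then have r_less: "r < 1 + norm x"
        using r2 by linarith
      \<comment> \<open>On the diameter through \<open>x\<close>, at distance exactly \<open>r\<close> away from the nearest boundary
        point \<open>e\<close>; this \<open>y\<close> just misses the open ball.\<close>
      define y where "y = (norm x - r) *\<^sub>R e"
      have xy: "dist x y = r"
        using dist_scaleR_unit[OF e(1), of "norm x" "norm x - r"] e(2) r by (simp add: y_def)
      have "norm y < 1"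
        using e(1) r_less r x by (simp add: y_def abs_less_iff)
      moreover have "dist x y < t * (dist x z + dist z y)" if "norm z = 1" for z
      proof -
        have "min (2 * (1 - norm x) + r) (2 * (1 + norm x) - r) \<le> dist x z + dist z y"
          using detour_between_diameter_points_ge[OF e(1) that, of "norm x" "norm x - r"]
            e(2) r r_less x by (simp add: y_def)
        then have "t * min (2 * (1 - norm x) + r) (2 * (1 + norm x) - r)
            \<le> t * (dist x z + dist z y)"
          using t by (intro mult_left_mono) auto
        moreover have "r < t * min (2 * (1 - norm x) + r) (2 * (1 + norm x) - r)"
          using r1[unfolded less_R1] r2[unfolded less_R2] by (simp add: min_def)
        ultimately show ?thesis
          using xy by linarith
      qed
      ultimately have "y \<in> triangular_ratio_ball (ball 0 1) x t"
        using mem_triangular_ratio_unit_ball_iff[OF xb] by blast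
      then show False
        using sub xy by auto
    qed
  qed
qed

theorem theorem3p4:
  fixes x :: "real ^ 'n" and t r\<^sub>0 r\<^sub>1 :: real
  assumes "x \<in> ball 0 1" and "0 < t" and "t < 1" and "r\<^sub>0 > 0" and "r\<^sub>1 > 0"
  shows "ball x r\<^sub>0 \<subseteq> triangular_ratio_ball (ball 0 1) x t \<and>
         triangular_ratio_ball (ball 0 1) x t \<subseteq> ball x r\<^sub>1 \<longleftrightarrow>
         (0 < r\<^sub>0 \<and> r\<^sub>0 \<le> 2 * t * (1 - norm x) / (1 + t)) \<and>
         r\<^sub>1 \<ge> min (2 * t * (1 - norm x) / (1 - t)) (2 * t * (1 + norm x) / (1 + t))"
proof -
  have "norm x < 1"
    using assms(1) by simp
  with assms show ?thesis
    by (simp only: ball_subset_triangular_ratio_unit_ball_iff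
        triangular_ratio_unit_ball_subset_ball_iff simp_thms)
qed

end
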